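(* Let $n\ge 1$ be an integer and let $A\in\mathbb R^{n\times n}$ be nonsingular and entrywise nonnegative. Then $$\|A^{-1}\|_F\ge \frac{2n}{n+1}\,\|A\|_{\max}^{-1}.$$ Moreover, equality holds if and only if $A$ is a positive multiple of an $S$-matrix of order $n$ (i.e. $A=\lambda S$ for some real $\lambda>0$ and some $S$-matrix $S$ of order $n$).
   Context: For a real matrix $A=(A_{ij})$, $\|A\|_F=\sqrt{\operatorname{trace}(A^TA)}$ is the Frobenius norm and $\|A\|_{\max}=\max_{i,j}|A_{ij}|$. Let $\mathbf 1$ denote the all-ones column vector in $\mathbb R^n$. An $S$-matrix of order $n$ is a matrix $S\in\{0,1\}^{n\times n}$ satisfying $S^TS=\frac{n+1}{4}(I+\mathbf 1\mathbf 1^T)$. *)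

theory Defs
  imports "HOL-Analysis.Analysis"
begin

definition frobenius_norm :: "real^'n^'m \<Rightarrow> real" where
  "frobenius_norm A = sqrt (trace (transpose A ** A))"

definition max_norm :: "real^'n^'m \<Rightarrow> real" where
  "max_norm A = Max {\<bar>A $ i $ j\<bar> | i j. True}"

(* The all-ones vector as an n x 1 matrix, so that its outer product with
   itself is a matrix product. *)
definition ones_column :: "real^1^'n" where
  "ones_column = columnvector (vec 1)"

definition S_matrix :: "real^'n^'n \<Rightarrow> bool" where
  "S_matrix S \<longleftrightarrow>
     (\<forall>i j. S $ i $ j \<in> {0, 1}) \<and>
     transpose S ** S =
       ((real CARD('n) + 1) / 4) *\<^sub>R (mat 1 + ones_column ** transpose ones_column)"

end

theory Submission
  imports Defs
begin

text \<open>
  After scaling, the entries of \<open>A\<close> lie in \<open>[0, 1]\<close>. Put \<open>N = n + 1\<close>, let \<open>r = A 1\<close> be the vector of row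
  sums and compare \<open>X = A\<^sup>-\<^sup>T\<close> with \<open>Y = A M\<^sup>-\<^sup>1 = (4/N) (A - r 1\<^sup>T / N)\<close>, where
  \<open>M = (N/4) (I + 1 1\<^sup>T)\<close> is the Gram matrix of an S-matrix. Since \<open>\<langle>X, Y\<rangle> = tr M\<^sup>-\<^sup>1 = 4n\<^sup>2/N\<^sup>2\<close>, one gets
  \<open>|X|\<^sup>2 = 4n\<^sup>2/N\<^sup>2 + |Y - X|\<^sup>2 - (16/N\<^sup>2) \<epsilon>\<close>, where the excess \<open>\<epsilon>\<close> is a sum over the rows of \<open>A\<close>.

  If \<open>n\<close> is odd, \<open>N/2\<close> is an integer, and every row contributes at most 0 to \<open>\<epsilon>\<close>, with equality iff
  the row is a 0/1 vector of sum \<open>N/2\<close>; then \<open>X = Y\<close> forces \<open>A\<^sup>T A = M\<close>.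

  If \<open>n\<close> is even, \<open>\<epsilon>\<close> may be positive, but \<open>D = Y - X\<close> is too large for equality. For columns
  \<open>j \<noteq> k\<close> and \<open>v = e\<^sub>j - e\<^sub>k\<close> one has \<open>\<langle>D v, A v\<rangle> = (4/N) (|A v|\<^sup>2 - N/2)\<close>; for a 0/1 matrix
  \<open>|A v|\<^sup>2\<close> is an integer and \<open>N/2\<close> is not, so \<open>|D v|\<close> is bounded below. Summing over all pairs and
  adding a lower bound for \<open>|D 1|\<close> gives \<open>|D|\<^sup>2 > (16/N\<^sup>2) \<epsilon>\<close>. Entries strictly between 0 and 1 are paid
  for by the terms \<open>a (1 - a)\<close>, the variances of a random rounding.
\<close>

section \<open>Random rounding and sums over pairs\<close>

text \<open>The left-hand side is the expectation of \<open>(Z - p) (Z - p - 1) \<ge> 0\<close> for the integer \<open>Z\<close> obtained by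
  rounding every \<open>q i\<close> independently to 1 with probability \<open>q i\<close> and to 0 otherwise.\<close>

lemma sum_integer_gap:
  fixes q :: "'a \<Rightarrow> real" and p :: int
  assumes "finite I" and "\<And>i. i \<in> I \<Longrightarrow> 0 \<le> q i \<and> q i \<le> 1"
  shows "(sum q I - p) * (sum q I - p - 1) + (\<Sum>i\<in>I. q i * (1 - q i)) \<ge> 0"
  using assms
proof (induction I arbitrary: p rule: finite_induct)
  case empty
  have "p * (p + 1) \<ge> 0" by (cases "p \<ge> 0") (auto simp: zero_le_mult_iff)
  then have "real_of_int (p * (p + 1)) \<ge> 0" by (simp only: of_int_0_le_iff)
  then show ?case by (simp add: algebra_simps)
next
  case (insert x I)
  define s v where "s = sum q I" and "v = (\<Sum>i\<in>I. q i * (1 - q i))"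
  have q: "0 \<le> q x" "q x \<le> 1" using insert.prems by auto
  have "(s - p) * (s - p - 1) + v \<ge> 0"
    unfolding s_def v_def using insert.IH insert.prems by simp
  moreover have "(s - (p - 1)) * (s - (p - 1) - 1) + v \<ge> 0"
    unfolding s_def v_def using insert.IH[of "p - 1"] insert.prems by simp
  \<comment> \<open>Condition on the rounding of \<open>x\<close>: value 0 keeps \<open>p\<close>,
    value 1 turns it into \<open>p - 1\<close>.\<close>
  ultimately have "(1 - q x) * ((s - p) * (s - p - 1) + v)
      + q x * ((s - (p - 1)) * (s - (p - 1) - 1) + v) \<ge> 0"
    using q by (metis add_nonneg_nonneg mult_nonneg_nonneg diff_ge_0_iff_ge)
  also have "(1 - q x) * ((s - p) * (s - p - 1) + v)
      + q x * ((s - (p - 1)) * (s - (p - 1) - 1) + v)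
    = (q x + s - p) * (q x + s - p - 1) + (q x * (1 - q x) + v)"
    by (simp add: algebra_simps)
  finally show ?case using insert.hyps by (simp add: s_def v_def)
qed

text \<open>Applied to each row of D, this expresses the sum of |D (e_j - e_k)|^2 over all pairs by
  |D|^2 and |D 1|^2; applied to A, it sums the column distances.\<close>

lemma sum_pairwise_diff_squared:
  fixes x :: "'n::finite \<Rightarrow> real"
  shows "(\<Sum>j\<in>UNIV. \<Sum>k\<in>UNIV. (x j - x k)\<^sup>2)
    = 2 * real CARD('n) * (\<Sum>j\<in>UNIV. (x j)\<^sup>2) - 2 * (\<Sum>j\<in>UNIV. x j)\<^sup>2"
proof -
  have "(\<Sum>j\<in>UNIV. \<Sum>k\<in>UNIV. (x j - x k)\<^sup>2)
      = (\<Sum>j\<in>UNIV. \<Sum>k\<in>(UNIV::'n set). (x j)\<^sup>2) + (\<Sum>j\<in>(UNIV::'n set). \<Sum>k\<in>UNIV. (x k)\<^sup>2)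
        - 2 * (\<Sum>j\<in>UNIV. \<Sum>k\<in>UNIV. x j * x k)"
    by (simp add: power2_diff sum.distrib sum_subtractf sum_distrib_left mult.assoc)
  also have "(\<Sum>j\<in>UNIV. \<Sum>k\<in>UNIV. x j * x k) = (\<Sum>j\<in>UNIV. x j)\<^sup>2"
    by (simp add: power2_eq_square sum_product)
  finally show ?thesis by (simp add: mult.assoc flip: sum_distrib_left)
qed

section \<open>The comparison matrix and the norm identity\<close>

locale unit_interval_inverse =
  fixes a b :: "'n::finite \<Rightarrow> 'n \<Rightarrow> real" and N :: real
  assumes range: "0 \<le> a i j" "a i j \<le> 1"
    and left_inverse: "(\<Sum>i\<in>UNIV. b j i * a i k) = (if j = k then 1 else 0)"
    and right_inverse: "(\<Sum>j\<in>UNIV. a i j * b j k) = (if i = k then 1 else 0)"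
    and N_eq: "N = real CARD('n) + 1"
begin

definition rowsum :: "'n \<Rightarrow> real" where
  "rowsum i = (\<Sum>j\<in>UNIV. a i j)"

text \<open>Entry of D = Y - X: the inverse of (N/4)(I + 1 1^T) is (4/N)(I - 1 1^T / N), and X is
  the transpose of \<open>b\<close>.\<close>

definition defect :: "'n \<Rightarrow> 'n \<Rightarrow> real" where
  "defect i j = 4 / N * (a i j - rowsum i / N) - b j i"

text \<open>This is (N^2/16)(|Y|^2 - 4 n^2/N^2), split by rows. The constant
  \<open>(N - 1) / 4\<close> makes a 0/1 row of sum \<open>N / 2\<close> contribute 0.\<close>

definition excess :: real where
  "excess = (\<Sum>i\<in>UNIV. (\<Sum>j\<in>UNIV. (a i j)\<^sup>2) - (N + 1) / N\<^sup>2 * (rowsum i)\<^sup>2 - (N - 1) / 4)"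

lemma card_eq: "real CARD('n) = N - 1"
  by (simp add: N_eq)

lemma N_ge: "N \<ge> 2"
proof -
  have "CARD('n) \<ge> 1" by (simp add: Suc_leI)
  then show ?thesis by (simp add: N_eq)
qed

lemma N_pos: "N > 0" using N_ge by simp

lemma inverse_rowsum: "(\<Sum>i\<in>UNIV. b j i * rowsum i) = 1"
proof -
  have "(\<Sum>i\<in>UNIV. b j i * rowsum i) = (\<Sum>i\<in>UNIV. \<Sum>k\<in>UNIV. b j i * a i k)"
    by (simp add: rowsum_def sum_distrib_left)
  also have "\<dots> = (\<Sum>k\<in>UNIV. \<Sum>i\<in>UNIV. b j i * a i k)" by (rule sum.swap)
  finally show ?thesis by (simp add: left_inverse)
qed

text \<open>Expand |Y - X|^2. The cross term is constant: tr (A B) = n and 1^T B r = n give <X, Y> =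
  (4/N)(n - n/N).\<close>

lemma inverse_norm_identity:
  "(\<Sum>i\<in>UNIV. \<Sum>j\<in>UNIV. (b j i)\<^sup>2)
    = 4 * (N - 1)\<^sup>2 / N\<^sup>2 + (\<Sum>i\<in>UNIV. \<Sum>j\<in>UNIV. (defect i j)\<^sup>2) - 16 / N\<^sup>2 * excess"
proof -
  have tr: "(\<Sum>i\<in>UNIV. \<Sum>j\<in>UNIV. a i j * b j i) = N - 1"
    by (simp add: right_inverse card_eq)
  have rb: "(\<Sum>i\<in>UNIV. \<Sum>j\<in>UNIV. rowsum i * b j i) = N - 1"
  proof -
    have "(\<Sum>i\<in>UNIV. \<Sum>j\<in>UNIV. rowsum i * b j i) = (\<Sum>j\<in>UNIV. \<Sum>i\<in>UNIV. b j i * rowsum i)"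
      by (subst sum.swap) (simp add: mult.commute)
    then show ?thesis by (simp add: inverse_rowsum card_eq)
  qed
  have row: "(\<Sum>j\<in>UNIV. (a i j - rowsum i / N)\<^sup>2)
      = (\<Sum>j\<in>UNIV. (a i j)\<^sup>2) - (N + 1) / N\<^sup>2 * (rowsum i)\<^sup>2" for i
  proof -
    have "(\<Sum>j\<in>UNIV. (a i j - rowsum i / N)\<^sup>2)
       = (\<Sum>j\<in>UNIV. (a i j)\<^sup>2) + (N - 1) * (rowsum i / N)\<^sup>2 - 2 * (rowsum i / N) * rowsum i"
      by (simp add: power2_diff sum.distrib sum_subtractf card_eq rowsum_def mult_ac
          flip: sum_distrib_left sum_distrib_right sum_divide_distrib)
    moreover have "(N - 1) * (rowsum i / N)\<^sup>2 - 2 * (rowsum i / N) * rowsum i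
        = - ((N + 1) / N\<^sup>2 * (rowsum i)\<^sup>2)"
      using N_pos by (simp add: field_simps power2_eq_square)
    ultimately show ?thesis by linarith
  qed
  have "(\<Sum>i\<in>UNIV. \<Sum>j\<in>UNIV. (defect i j)\<^sup>2)
      = (\<Sum>i\<in>UNIV. \<Sum>j\<in>UNIV. 16 / N\<^sup>2 * (a i j - rowsum i / N)\<^sup>2
          - 8 / N * (a i j * b j i) + 8 / N\<^sup>2 * (rowsum i * b j i) + (b j i)\<^sup>2)"
    by (intro sum.cong refl) (simp add: defect_def algebra_simps divide_inverse power2_eq_square)
  also have "\<dots> = 16 / N\<^sup>2 * (\<Sum>i\<in>UNIV. \<Sum>j\<in>UNIV. (a i j - rowsum i / N)\<^sup>2)
      - 8 / N * (N - 1) + 8 / N\<^sup>2 * (N - 1) + (\<Sum>i\<in>UNIV. \<Sum>j\<in>UNIV. (b j i)\<^sup>2)"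
    unfolding sum.distrib sum_subtractf sum_distrib_left[symmetric]
    using tr rb by (simp add: sum_distrib_left)
  also have "(\<Sum>i\<in>UNIV. \<Sum>j\<in>UNIV. (a i j - rowsum i / N)\<^sup>2) = excess + (N - 1)\<^sup>2 / 4"
    unfolding row excess_def sum_subtractf by (simp add: card_eq power2_eq_square)
  also have "16 / N\<^sup>2 * (excess + (N - 1)\<^sup>2 / 4) - 8 / N * (N - 1) + 8 / N\<^sup>2 * (N - 1)
      = 16 / N\<^sup>2 * excess - 4 * (N - 1)\<^sup>2 / N\<^sup>2"
    using N_pos by (simp add: field_simps power2_eq_square)
  finally show ?thesis by linarith
qed

lemma excess_eq:
  "excess = (\<Sum>i\<in>UNIV. \<Sum>j\<in>UNIV. (a i j)\<^sup>2) - (N + 1) / N\<^sup>2 * (\<Sum>i\<in>UNIV. (rowsum i)\<^sup>2) - (N - 1)\<^sup>2 / 4"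
  unfolding excess_def sum_subtractf sum_distrib_left[symmetric]
  by (simp add: card_eq power2_eq_square)

text \<open>Let x be the deviation of the row sum from \<open>N / 2\<close>. The terms in x are
  positive only for -N/(N+1) < x < 0. This interval contains no integer, but it contains -1/2,
  whence the split by parity.\<close>

lemma row_excess:
  "(\<Sum>j\<in>UNIV. (a i j)\<^sup>2) - (N + 1) / N\<^sup>2 * (rowsum i)\<^sup>2 - (N - 1) / 4
    = - (\<Sum>j\<in>UNIV. a i j * (1 - a i j)) - (rowsum i - N / 2) / N
      - (N + 1) / N\<^sup>2 * (rowsum i - N / 2)\<^sup>2"
proof -
  have "(\<Sum>j\<in>UNIV. (a i j)\<^sup>2) = rowsum i - (\<Sum>j\<in>UNIV. a i j * (1 - a i j))"
    by (simp add: rowsum_def algebra_simps sum_subtractf power2_eq_square)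
  moreover have "(N + 1) / N\<^sup>2 * (rowsum i)\<^sup>2 + (N - 1) / 4 - rowsum i
      = (rowsum i - N / 2) / N + (N + 1) / N\<^sup>2 * (rowsum i - N / 2)\<^sup>2"
    using N_pos by (simp add: field_simps power2_eq_square)
  ultimately show ?thesis by linarith
qed

lemma row_integer_gap:
  "(rowsum i - real_of_int p) * (rowsum i - real_of_int p - 1) + (\<Sum>j\<in>UNIV. a i j * (1 - a i j)) \<ge> 0"
  unfolding rowsum_def by (rule sum_integer_gap) (auto simp: range)

section \<open>Odd order: no row has positive excess\<close>

text \<open>Subtracting 1/N times the integer gap x (x + 1) + e >= 0 cancels the linear term in x
  and leaves two separate penalties, which decide the equality case.\<close>

lemma row_excess_odd:
  assumes "odd CARD('n)"
  shows "(\<Sum>j\<in>UNIV. (a i j)\<^sup>2) - (N + 1) / N\<^sup>2 * (rowsum i)\<^sup>2 - (N - 1) / 4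
    \<le> - ((rowsum i - N / 2)\<^sup>2 / N\<^sup>2) - (1 - 1 / N) * (\<Sum>j\<in>UNIV. a i j * (1 - a i j))"
proof -
  define x e where "x = rowsum i - N / 2" and "e = (\<Sum>j\<in>UNIV. a i j * (1 - a i j))"
  obtain p where p: "CARD('n) = 2 * p + 1" using assms by (elim oddE)
  have "N = 2 * real p + 2" by (simp add: N_eq p)
  \<comment> \<open>Here \<open>N / 2 = p + 1\<close>, so the gap above \<open>p\<close> lies
    between x = -1 and x = 0.\<close>
  then have "x * (x + 1) + e \<ge> 0"
    using row_integer_gap[of i "int p", folded e_def]
    by (simp add: x_def add_divide_distrib algebra_simps)
  then have "(x * (x + 1) + e) / N \<ge> 0" using N_pos by simp
  then have "- e - x / N - (N + 1) / N\<^sup>2 * x\<^sup>2 \<le> - (x\<^sup>2 / N\<^sup>2) - (1 - 1 / N) * e"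
  proof -
    have "- (x\<^sup>2 / N\<^sup>2) - (1 - 1 / N) * e - (- e - x / N - (N + 1) / N\<^sup>2 * x\<^sup>2) = (x * (x + 1) + e) / N"
      using N_pos by (simp add: field_simps power2_eq_square)
    with \<open>(x * (x + 1) + e) / N \<ge> 0\<close> show ?thesis by linarith
  qed
  then show ?thesis unfolding row_excess x_def e_def .
qed

lemma zero_one_if_deficit:
  assumes "(\<Sum>j\<in>UNIV. a i j * (1 - a i j)) = 0"
  shows "a i j \<in> {0, 1}"
proof -
  have "\<forall>j\<in>UNIV. a i j * (1 - a i j) = 0"
    using assms by (subst (asm) sum_nonneg_eq_0_iff) (auto simp: range)
  then show ?thesis by auto
qed

lemma row_excess_odd_terms_nonneg:
  "0 \<le> (rowsum i - N / 2)\<^sup>2 / N\<^sup>2"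
  "0 \<le> (1 - 1 / N) * (\<Sum>j\<in>UNIV. a i j * (1 - a i j))"
proof -
  show "0 \<le> (1 - 1 / N) * (\<Sum>j\<in>UNIV. a i j * (1 - a i j))"
    using N_ge by (intro mult_nonneg_nonneg sum_nonneg) (auto simp: range)
qed simp

lemma row_excess_odd_le:
  assumes "odd CARD('n)"
  shows "(\<Sum>j\<in>UNIV. (a i j)\<^sup>2) - (N + 1) / N\<^sup>2 * (rowsum i)\<^sup>2 - (N - 1) / 4 \<le> 0"
  using row_excess_odd[OF assms, of i] row_excess_odd_terms_nonneg[of i] by linarith

lemma excess_odd_le:
  assumes "odd CARD('n)"
  shows "excess \<le> 0"
  unfolding excess_def by (intro sum_nonpos row_excess_odd_le assms)

lemma excess_odd_eq:
  assumes "odd CARD('n)" and "excess = 0"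
  shows "rowsum i = N / 2" and "a i j \<in> {0, 1}"
proof -
  define f where "f i = (\<Sum>j\<in>UNIV. (a i j)\<^sup>2) - (N + 1) / N\<^sup>2 * (rowsum i)\<^sup>2 - (N - 1) / 4" for i
  have "(\<Sum>i\<in>UNIV. - f i) = 0"
    using assms(2) unfolding excess_def f_def sum_negf by simp
  moreover have "- f i \<ge> 0" for i
    using row_excess_odd_le[OF assms(1)] by (simp add: f_def)
  ultimately have "\<forall>i\<in>UNIV. - f i = 0"
    by (subst (asm) sum_nonneg_eq_0_iff) auto
  then have "(\<Sum>j\<in>UNIV. (a i j)\<^sup>2) - (N + 1) / N\<^sup>2 * (rowsum i)\<^sup>2 - (N - 1) / 4 = 0"
    by (simp add: f_def)
  then have "(rowsum i - N / 2)\<^sup>2 / N\<^sup>2 = 0" "(1 - 1 / N) * (\<Sum>j\<in>UNIV. a i j * (1 - a i j)) = 0"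
    using row_excess_odd[OF assms(1), of i] row_excess_odd_terms_nonneg[of i] by linarith+
  then show "rowsum i = N / 2" and "a i j \<in> {0, 1}"
    using N_ge zero_one_if_deficit[of i j] by auto
qed

section \<open>Even order: distances between columns\<close>

definition coldist :: "'n \<Rightarrow> 'n \<Rightarrow> real" where
  "coldist j k = (\<Sum>i\<in>UNIV. (a i j - a i k)\<^sup>2)"

definition coldeficit :: "'n \<Rightarrow> real" where
  "coldeficit j = (\<Sum>i\<in>UNIV. a i j * (1 - a i j))"

text \<open>\<open>N / 2\<close> is a half-integer, so integer distances stay at least 1/2 away from
  it. The correction for fractional entries carries the factor \<open>coldist j k\<close> because
  the bound is later divided by this distance.\<close>

lemma coldist_integer_gap:
  assumes "even CARD('n)"
  shows "(coldist j k - N / 2)\<^sup>2 \<ge> 1 / 4 - (coldeficit j + coldeficit k) * coldist j k"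
proof -
  \<comment> \<open>the probability that the random roundings of \<open>a i j\<close> and \<open>a i k\<close> differ\<close>
  define q where "q i = a i j + a i k - 2 * (a i j * a i k)" for i
  define d where "d = coldeficit j + coldeficit k"
  obtain p where p: "CARD('n) = 2 * p" using assms by (elim evenE)
  have Np: "N = 2 * real p + 1" by (simp add: N_eq p)
  have q: "0 \<le> q i \<and> q i \<le> 1" for i
  proof -
    have "a i j * (1 - a i k) + a i k * (1 - a i j) \<ge> 0"
      "a i j * a i k + (1 - a i j) * (1 - a i k) \<ge> 0"
      by (intro add_nonneg_nonneg mult_nonneg_nonneg; simp add: range)+
    then show ?thesis by (simp add: q_def algebra_simps)
  qed
  have sq: "sum q UNIV = coldist j k + d"
    by (simp add: q_def coldist_def d_def coldeficit_def flip: sum.distrib)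
      (simp add: algebra_simps power2_eq_square)
  have v: "(\<Sum>i\<in>UNIV. q i * (1 - q i)) \<le> d"
    unfolding d_def coldeficit_def sum.distrib[symmetric]
  proof (rule sum_mono)
    fix i
    have "a i j * (1 - a i j) + a i k * (1 - a i k) - q i * (1 - q i)
      = 4 * ((a i j * (1 - a i j)) * (a i k * (1 - a i k)))"
      by (simp add: q_def algebra_simps)
    moreover have "(a i j * (1 - a i j)) * (a i k * (1 - a i k)) \<ge> 0"
      by (intro mult_nonneg_nonneg) (auto simp: range)
    ultimately show "q i * (1 - q i) \<le> a i j * (1 - a i j) + a i k * (1 - a i k)" by linarith
  qed
  have "(sum q UNIV - real_of_int (int p)) * (sum q UNIV - real_of_int (int p) - 1)
      + (\<Sum>i\<in>UNIV. q i * (1 - q i)) \<ge> 0"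
    by (rule sum_integer_gap) (auto simp: q)
  then have 1: "(coldist j k + d - p) * (coldist j k + d - p - 1) + d \<ge> 0"
    using v by (simp add: sq)
  have "sum q UNIV \<le> N - 1"
    using sum_mono[of UNIV q "\<lambda>_. 1"] q by (simp add: card_eq)
  then have "coldist j k + d \<le> N - 1" by (simp add: sq)
  moreover have "d \<ge> 0"
    unfolding d_def coldeficit_def by (intro add_nonneg_nonneg sum_nonneg) (auto simp: range)
  ultimately have "d * (N - 1 - d - coldist j k) \<ge> 0" by simp
  moreover have "(coldist j k - N / 2)\<^sup>2 - 1 / 4 + d * coldist j k
    = ((coldist j k + d - p) * (coldist j k + d - p - 1) + d) + d * (N - 1 - d - coldist j k)"
    unfolding Np by (simp add: field_simps power2_eq_square)
  ultimately show ?thesis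
    using 1 unfolding d_def[symmetric] by linarith
qed

text \<open>For v = e_j - e_k the rank-one part of Y vanishes, as 1^T v = 0, so <Y v, A v> = (4/N)
  |A v|^2; and <X v, A v> = |v|^2 = 2.\<close>

lemma defect_coldiff:
  assumes "j \<noteq> k"
  shows "(\<Sum>i\<in>UNIV. (defect i j - defect i k) * (a i j - a i k)) = 4 / N * (coldist j k - N / 2)"
proof -
  have "(\<Sum>i\<in>UNIV. (defect i j - defect i k) * (a i j - a i k))
    = (\<Sum>i\<in>UNIV. 4 / N * (a i j - a i k)\<^sup>2 - b j i * a i j + b j i * a i k + b k i * a i j - b k i * a i k)"
    by (intro sum.cong refl) (use N_pos in \<open>simp add: defect_def field_simps power2_eq_square\<close>)
  also have "\<dots> = 4 / N * coldist j k - 2"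
    using assms by (simp add: sum.distrib sum_subtractf left_inverse coldist_def sum_distrib_left)
  finally show ?thesis using N_pos by (simp add: field_simps)
qed

text \<open>Cauchy-Schwarz for D v and A v, combined with the integer gap and divided by
  \<open>coldist j k\<close>.\<close>

lemma defect_coldiff_norm:
  assumes "even CARD('n)" and "j \<noteq> k"
  shows "N\<^sup>2 / 16 * (\<Sum>i\<in>UNIV. (defect i j - defect i k)\<^sup>2)
    \<ge> (N - coldist j k) / N\<^sup>2 - coldeficit j - coldeficit k"
proof -
  define h s where "h = coldist j k" and "s = (\<Sum>i\<in>UNIV. (defect i j - defect i k)\<^sup>2)"
  have "(4 / N * (h - N / 2))\<^sup>2 \<le> s * h"
    using Cauchy_Schwarz_ineq_sum[of "\<lambda>i. defect i j - defect i k" "\<lambda>i. a i j - a i k" UNIV]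
    unfolding defect_coldiff[OF assms(2)] by (simp add: h_def s_def coldist_def)
  then have cs: "(h - N / 2)\<^sup>2 \<le> N\<^sup>2 / 16 * s * h"
    using N_pos by (simp add: field_simps power2_eq_square)
  have h: "h > 0"
  proof -
    have "h \<ge> 0" unfolding h_def coldist_def by (intro sum_nonneg) auto
    moreover have "h \<noteq> 0"
      using cs N_pos by auto
    ultimately show ?thesis by simp
  qed
  \<comment> \<open>Replaces \<open>1 / (4 * h)\<close> by its tangent at \<open>h = N / 2\<close>, which can be summed over all pairs.\<close>
  have "(h / N - 1 / 2)\<^sup>2 \<ge> 0" by simp
  then have "h * ((N - h) / N\<^sup>2) \<le> 1 / 4"
    using N_pos by (simp add: field_simps power2_eq_square)
  moreover have "h * ((N - h) / N\<^sup>2 - coldeficit j - coldeficit k)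
      = h * ((N - h) / N\<^sup>2) - (coldeficit j + coldeficit k) * h"
    by (simp add: algebra_simps del: times_divide_eq_right)
  moreover have "h * (N\<^sup>2 / 16 * s) = N\<^sup>2 / 16 * s * h" by (simp only: mult.commute)
  ultimately have "h * ((N - h) / N\<^sup>2 - coldeficit j - coldeficit k) \<le> h * (N\<^sup>2 / 16 * s)"
    using coldist_integer_gap[OF assms(1), of j k] cs unfolding h_def[symmetric] by linarith
  with h show ?thesis by (simp add: h_def s_def)
qed

text \<open>Here Y 1 = (4/N^2) A 1, and <X 1, A 1> = 1^T B A 1 = n.\<close>

lemma sum_defect_rowsum:
  "(\<Sum>i\<in>UNIV. (\<Sum>j\<in>UNIV. defect i j) * rowsum i) = 4 / N\<^sup>2 * (\<Sum>i\<in>UNIV. (rowsum i)\<^sup>2) - (N - 1)"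
proof -
  have "(\<Sum>j\<in>UNIV. defect i j) = 4 / N\<^sup>2 * rowsum i - (\<Sum>j\<in>UNIV. b j i)" for i
  proof -
    have "(\<Sum>j\<in>UNIV. defect i j) = 4 / N * (rowsum i - (N - 1) * (rowsum i / N)) - (\<Sum>j\<in>UNIV. b j i)"
      unfolding defect_def sum_subtractf sum_distrib_left[symmetric] by (simp add: card_eq rowsum_def)
    then show ?thesis using N_pos by (simp add: field_simps power2_eq_square)
  qed
  then have "(\<Sum>i\<in>UNIV. (\<Sum>j\<in>UNIV. defect i j) * rowsum i)
    = 4 / N\<^sup>2 * (\<Sum>i\<in>UNIV. (rowsum i)\<^sup>2) - (\<Sum>i\<in>UNIV. \<Sum>j\<in>UNIV. b j i * rowsum i)"
    by (simp add: left_diff_distrib sum_subtractf sum_distrib_left sum_distrib_right power2_eq_square mult.assoc)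
  also have "(\<Sum>i\<in>UNIV. \<Sum>j\<in>UNIV. b j i * rowsum i) = N - 1"
    by (subst sum.swap) (simp add: inverse_rowsum card_eq)
  finally show ?thesis .
qed

text \<open>Expanding |D 1 + c A 1|^2 >= 0 for a fixed c gives a bound linear in |A 1|^2, which can
  be added to the sum over pairs.\<close>

lemma sum_defect_sq:
  "(\<Sum>i\<in>UNIV. (\<Sum>j\<in>UNIV. defect i j)\<^sup>2)
    \<ge> - 8 / N ^ 3 * (4 / N\<^sup>2 * (\<Sum>i\<in>UNIV. (rowsum i)\<^sup>2) - (N - 1)) - 16 / N ^ 6 * (\<Sum>i\<in>UNIV. (rowsum i)\<^sup>2)"
proof -
  \<comment> \<open>The near-optimal multiplier for even \<open>n\<close>, where row sums near \<open>n / 2\<close> are the critical case.\<close>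
  have "0 \<le> (\<Sum>i\<in>UNIV. ((\<Sum>j\<in>UNIV. defect i j) + 4 / N ^ 3 * rowsum i)\<^sup>2)"
    by (intro sum_nonneg) auto
  also have "\<dots> = (\<Sum>i\<in>UNIV. (\<Sum>j\<in>UNIV. defect i j)\<^sup>2
      + 8 / N ^ 3 * ((\<Sum>j\<in>UNIV. defect i j) * rowsum i) + 16 / N ^ 6 * (rowsum i)\<^sup>2)"
    by (intro sum.cong refl)
      (simp add: power2_sum power_mult_distrib power_divide flip: power_mult)
  also have "\<dots> = (\<Sum>i\<in>UNIV. (\<Sum>j\<in>UNIV. defect i j)\<^sup>2)
      + 8 / N ^ 3 * (4 / N\<^sup>2 * (\<Sum>i\<in>UNIV. (rowsum i)\<^sup>2) - (N - 1)) + 16 / N ^ 6 * (\<Sum>i\<in>UNIV. (rowsum i)\<^sup>2)"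
    by (simp only: sum.distrib sum_defect_rowsum flip: sum_distrib_left)
  finally show ?thesis by simp
qed

section \<open>Even order: the strict inequality\<close>

text \<open>The pairwise bounds add up to a bound on n |D|^2 - |D 1|^2; the bound on |D 1|^2 then
  leaves a scalar inequality in \<xi>, \<sigma> and \<Delta>.\<close>

lemma defect_norm_even:
  assumes "even CARD('n)"
  shows "(\<Sum>i\<in>UNIV. \<Sum>j\<in>UNIV. (defect i j)\<^sup>2) > 16 / N\<^sup>2 * excess"
proof -
  define n where "n = N - 1"
  define DD dd where "DD = (\<Sum>i\<in>UNIV. \<Sum>j\<in>UNIV. (defect i j)\<^sup>2)"
    and "dd = (\<Sum>i\<in>UNIV. (\<Sum>j\<in>UNIV. defect i j)\<^sup>2)"
  define \<tau> \<rho> where "\<tau> = (\<Sum>i\<in>UNIV. \<Sum>j\<in>UNIV. (a i j)\<^sup>2)" and "\<rho> = (\<Sum>i\<in>UNIV. (rowsum i)\<^sup>2)"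
  define \<Delta> where "\<Delta> = (\<Sum>i\<in>UNIV. \<Sum>j\<in>UNIV. a i j * (1 - a i j))"
  define \<xi> \<sigma> where "\<xi> = (\<Sum>i\<in>UNIV. rowsum i - N / 2)" and "\<sigma> = (\<Sum>i\<in>UNIV. (rowsum i - N / 2)\<^sup>2)"
  have N: "N = n + 1" and card: "real CARD('n) = n" by (simp_all add: n_def card_eq)
  have n: "n \<ge> 2"
  proof -
    have "CARD('n) \<ge> 2"
      using assms by (metis One_nat_def Suc_leI le_neq_implies_less numeral_2_eq_2 odd_one zero_less_card_finite)
    then show ?thesis using card by linarith
  qed
  have coldef: "(\<Sum>j\<in>UNIV. coldeficit j) = \<Delta>"
    unfolding coldeficit_def \<Delta>_def by (rule sum.swap)
  have sum_dist: "(\<Sum>j\<in>UNIV. \<Sum>k\<in>UNIV. coldist j k) = 2 * n * \<tau> - 2 * \<rho>"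
  proof -
    have "(\<Sum>j\<in>UNIV. \<Sum>k\<in>UNIV. coldist j k)
        = (\<Sum>i\<in>UNIV. \<Sum>j\<in>UNIV. \<Sum>k\<in>UNIV. (a i j - a i k)\<^sup>2)"
      unfolding coldist_def by (subst sum.swap, subst sum.swap, intro sum.cong refl sum.swap)
    then show ?thesis
      by (simp add: sum_pairwise_diff_squared card sum_subtractf \<tau>_def \<rho>_def rowsum_def
          flip: sum_distrib_left)
  qed
  have sum_defect: "(\<Sum>j\<in>UNIV. \<Sum>k\<in>UNIV. \<Sum>i\<in>UNIV. (defect i j - defect i k)\<^sup>2) = 2 * n * DD - 2 * dd"
  proof -
    have "(\<Sum>j\<in>UNIV. \<Sum>k\<in>UNIV. \<Sum>i\<in>UNIV. (defect i j - defect i k)\<^sup>2)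
        = (\<Sum>i\<in>UNIV. \<Sum>j\<in>UNIV. \<Sum>k\<in>UNIV. (defect i j - defect i k)\<^sup>2)"
      by (subst sum.swap, subst sum.swap, intro sum.cong refl sum.swap)
    then show ?thesis
      by (simp add: sum_pairwise_diff_squared card sum_subtractf DD_def dd_def
          flip: sum_distrib_left)
  qed
  \<comment> \<open>The pairwise bound holds for \<open>j \<noteq> k\<close>; the \<open>if\<close>
    term is the exact left side on the diagonal, where the distance is 0.\<close>
  have "(\<Sum>j\<in>UNIV. \<Sum>k\<in>UNIV. (N - coldist j k) / N\<^sup>2 - coldeficit j - coldeficit k)
    \<le> (\<Sum>j\<in>UNIV. \<Sum>k\<in>UNIV. N\<^sup>2 / 16 * (\<Sum>i\<in>UNIV. (defect i j - defect i k)\<^sup>2)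
        + (if j = k then 1 / N - 2 * coldeficit j else 0))"
  proof (intro sum_mono)
    fix j k
    show "(N - coldist j k) / N\<^sup>2 - coldeficit j - coldeficit k
      \<le> N\<^sup>2 / 16 * (\<Sum>i\<in>UNIV. (defect i j - defect i k)\<^sup>2)
        + (if j = k then 1 / N - 2 * coldeficit j else 0)"
      using defect_coldiff_norm[OF assms, of j k] by (auto simp: coldist_def power2_eq_square)
  qed
  also have "\<dots> = N\<^sup>2 / 16 * (2 * n * DD - 2 * dd) + (n / N - 2 * \<Delta>)"
    unfolding sum.distrib sum_distrib_left[symmetric] sum_defect
    by (simp add: sum_subtractf card flip: coldef sum_distrib_left)
  also have "(\<Sum>j\<in>UNIV. \<Sum>k\<in>UNIV. (N - coldist j k) / N\<^sup>2 - coldeficit j - coldeficit k)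
    = (n * n * N - (2 * n * \<tau> - 2 * \<rho>)) / N\<^sup>2 - 2 * n * \<Delta>"
    by (simp add: sum_subtractf coldef card sum_dist flip: sum_distrib_left sum_divide_distrib)
  finally have "N\<^sup>2 / 2 * ((n * n * N - (2 * n * \<tau> - 2 * \<rho>)) / N\<^sup>2 - 2 * n * \<Delta>)
    \<le> N\<^sup>2 / 2 * (N\<^sup>2 / 16 * (2 * n * DD - 2 * dd) + (n / N - 2 * \<Delta>))"
    by (intro mult_left_mono) auto
  moreover have "N\<^sup>2 / 2 * ((n * n * N - (2 * n * \<tau> - 2 * \<rho>)) / N\<^sup>2 - 2 * n * \<Delta>)
    = n * n * N / 2 - n * \<tau> + \<rho> - n * N\<^sup>2 * \<Delta>"
    using N_pos by (simp add: field_simps)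
  moreover have "N\<^sup>2 / 2 * (N\<^sup>2 / 16 * (2 * n * DD - 2 * dd) + (n / N - 2 * \<Delta>))
    = N ^ 4 / 16 * (n * DD) - N ^ 4 / 16 * dd + n * N / 2 - N\<^sup>2 * \<Delta>"
    using N_pos by (simp add: field_simps eval_nat_numeral)
  ultimately have A: "n * n * N / 2 - n * \<tau> + \<rho> - n * N\<^sup>2 * \<Delta> - n * N / 2 + N\<^sup>2 * \<Delta> + N ^ 4 / 16 * dd
    \<le> N ^ 4 / 16 * (n * DD)"
    by linarith
  have "N ^ 4 / 16 * (- 8 / N ^ 3 * (4 / N\<^sup>2 * \<rho> - n) - 16 / N ^ 6 * \<rho>) \<le> N ^ 4 / 16 * dd"
    unfolding dd_def \<rho>_def n_def using sum_defect_sq N_pos by (intro mult_left_mono) auto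
  also have "N ^ 4 / 16 * (- 8 / N ^ 3 * (4 / N\<^sup>2 * \<rho> - n) - 16 / N ^ 6 * \<rho>)
    = n * N / 2 - 2 * \<rho> / N - \<rho> / N\<^sup>2"
    using N_pos by (simp add: field_simps eval_nat_numeral)
  finally have B: "n * N / 2 - 2 * \<rho> / N - \<rho> / N\<^sup>2 \<le> N ^ 4 / 16 * dd" .
  have \<tau>: "\<tau> = n * N / 2 + \<xi> - \<Delta>"
    by (simp add: \<tau>_def \<xi>_def \<Delta>_def rowsum_def sum_subtractf card algebra_simps power2_eq_square)
  have \<rho>: "\<rho> = n * N\<^sup>2 / 4 + N * \<xi> + \<sigma>"
    by (simp add: \<rho>_def \<xi>_def \<sigma>_def power2_diff sum.distrib sum_subtractf card algebra_simps
        power2_eq_square sum_distrib_left flip: sum_divide_distrib)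
  have ex: "excess = \<tau> - (N + 1) / N\<^sup>2 * \<rho> - n\<^sup>2 / 4"
    by (simp add: excess_eq \<tau>_def \<rho>_def n_def)
  \<comment> \<open>Each row gives 1/4: with p = n/2 the integer gap reads (x + 1/2)(x - 1/2) + e >=
    0 for its deviation x and deficit e.\<close>
  have gap: "\<sigma> + \<Delta> \<ge> n / 4"
  proof -
    obtain p where p: "CARD('n) = 2 * p" using assms by (elim evenE)
    have "N = 2 * real p + 1" by (simp add: N_eq p)
    then have "(rowsum i - N / 2)\<^sup>2 + (\<Sum>j\<in>UNIV. a i j * (1 - a i j)) \<ge> 1 / 4" for i
      using row_integer_gap[of i "int p"] by (simp add: power2_eq_square field_simps)
    then have "(\<Sum>i\<in>(UNIV::'n set). 1 / 4)
      \<le> (\<Sum>i\<in>UNIV. (rowsum i - N / 2)\<^sup>2 + (\<Sum>j\<in>UNIV. a i j * (1 - a i j)))"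
      by (intro sum_mono)
    then show ?thesis by (simp add: sum.distrib card \<sigma>_def \<Delta>_def)
  qed
  have cs: "\<xi>\<^sup>2 \<le> n * \<sigma>"
    using Cauchy_Schwarz_ineq_sum[of "\<lambda>_. 1" "\<lambda>i. rowsum i - N / 2" UNIV]
    by (simp add: \<xi>_def \<sigma>_def card)
  have \<Delta>: "\<Delta> \<ge> 0" unfolding \<Delta>_def by (intro sum_nonneg) (auto simp: range)
  define u where "u = 1 / N"
  have u: "N * u = 1" "u > 0" "u \<le> 1 / 3" using n N by (auto simp: u_def field_simps)
  \<comment> \<open>These are the coefficients of \<xi> and \<sigma> in the final
    difference.\<close>
  define \<beta> \<kappa> where "\<beta> = N\<^sup>2 - N - 1 - u" and "\<kappa> = N\<^sup>2 - 2 * u - u\<^sup>2"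
  have "u\<^sup>2 < 1" using u(2,3) by (simp add: power_less_one_iff)
  have \<beta>: "\<beta> \<ge> 0"
  proof -
    have "N * 3 \<le> N * N" using n N by (intro mult_left_mono) auto
    then show ?thesis using u n N by (simp add: \<beta>_def power2_eq_square)
  qed
  have \<kappa>\<beta>: "\<kappa> - \<beta> \<ge> 0" using u n N \<open>u\<^sup>2 < 1\<close> by (simp add: \<beta>_def \<kappa>_def)
  \<comment> \<open>Minimises \<sigma> + \<xi> subject to \<xi>^2 <= n \<sigma>; the extremal case
    has all row sums equal to n/2.\<close>
  have "0 \<le> (\<xi> + n / 2)\<^sup>2" by simp
  then have "- n / 4 * n \<le> \<xi>\<^sup>2 + n * \<xi>" by (simp add: power2_eq_square algebra_simps)
  also have "\<dots> \<le> (\<sigma> + \<xi>) * n" using cs by (simp add: algebra_simps)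
  finally have "- n / 4 \<le> \<sigma> + \<xi>" by (rule mult_right_le_imp_le) (use n in simp)
  \<comment> \<open>Split \<kappa> into \<beta> and \<kappa> - \<beta>: the first share offsets the
    term \<beta> \<xi>, the second uses \<open>gap\<close>.\<close>
  then have "\<beta> * (- n / 4) \<le> \<beta> * (\<sigma> + \<Delta> + \<xi>)" using \<beta> \<Delta> by (intro mult_left_mono) auto
  moreover have "(\<kappa> - \<beta>) * (n / 4) \<le> (\<kappa> - \<beta>) * (\<sigma> + \<Delta>)" using \<kappa>\<beta> gap by (intro mult_left_mono)
  ultimately have "n / 4 * (N\<^sup>2 - 2 * N - 1 + \<kappa> - 2 * \<beta>)
      \<le> n * (N\<^sup>2 - 2 * N - 1) / 4 + \<beta> * \<xi> + \<kappa> * (\<sigma> + \<Delta>)"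
    by (simp add: algebra_simps add_divide_distrib diff_divide_distrib)
  \<comment> \<open>The terms in \<open>N\<close> inside the bracket cancel; the remaining margin is
    strict because \<open>u\<close> is below 1.\<close>
  moreover have "n / 4 * (N\<^sup>2 - 2 * N - 1 + \<kappa> - 2 * \<beta>) = n / 4 * (1 - u\<^sup>2)"
    by (simp add: \<beta>_def \<kappa>_def)
  moreover have "n / 4 * (1 - u\<^sup>2) > 0" using n \<open>u\<^sup>2 < 1\<close> by simp
  moreover have "\<kappa> * \<Delta> \<le> (N\<^sup>2 + n) * \<Delta>"
    using \<Delta> u n zero_le_power2[of u] unfolding \<kappa>_def by (intro mult_right_mono) linarith+
  ultimately have pos: "0 < n * (N\<^sup>2 - 2 * N - 1) / 4 + \<beta> * \<xi> + \<kappa> * \<sigma> + (N\<^sup>2 + n) * \<Delta>"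
    by (simp add: algebra_simps)
  have "n * n * N / 2 - n * \<tau> + \<rho> - n * N\<^sup>2 * \<Delta> - n * N / 2 + N\<^sup>2 * \<Delta>
      + (n * N / 2 - 2 * \<rho> / N - \<rho> / N\<^sup>2) - n * N\<^sup>2 * excess
    = n * (N\<^sup>2 - 2 * N - 1) / 4 + \<beta> * \<xi> + \<kappa> * \<sigma> + (N\<^sup>2 + n) * \<Delta>"
    unfolding ex \<tau> \<rho> \<beta>_def \<kappa>_def u_def n_def using N_pos
    by (simp add: field_simps power2_eq_square)
  with A B pos have "n * N\<^sup>2 * excess < N ^ 4 / 16 * (n * DD)" by linarith
  also have "N ^ 4 / 16 * (n * DD) = n * N\<^sup>2 * (N\<^sup>2 / 16 * DD)" by (simp add: power4_eq_xxxx power2_eq_square)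
  finally have "excess < N\<^sup>2 / 16 * DD"
    by (rule mult_left_less_imp_less) (use n in simp)
  then show ?thesis using N_pos unfolding DD_def by (simp add: field_simps)
qed

section \<open>The bound and its equality case for entries in the unit interval\<close>

lemma inverse_norm_ge:
  "4 * (N - 1)\<^sup>2 / N\<^sup>2 \<le> (\<Sum>i\<in>UNIV. \<Sum>j\<in>UNIV. (b j i)\<^sup>2)"
proof (cases "even CARD('n)")
  case True
  then show ?thesis using inverse_norm_identity defect_norm_even by simp
next
  case False
  have "16 / N\<^sup>2 * excess \<le> 0"
    using excess_odd_le[OF False] by (intro mult_nonneg_nonpos) auto
  moreover have "0 \<le> (\<Sum>i\<in>UNIV. \<Sum>j\<in>UNIV. (defect i j)\<^sup>2)" by (intro sum_nonneg) auto
  ultimately show ?thesis using inverse_norm_identity by linarith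
qed

text \<open>Equality excludes even order and forces both the excess and D to vanish. Then X = Y with
  row sums \<open>N / 2\<close> gives \<open>b\<close> explicitly, and B A = I determines the Gram
  matrix up to the column sums.\<close>

lemma inverse_norm_eq_imp:
  assumes "(\<Sum>i\<in>UNIV. \<Sum>j\<in>UNIV. (b j i)\<^sup>2) = 4 * (N - 1)\<^sup>2 / N\<^sup>2"
  shows "a i j \<in> {0, 1}"
    and "(\<Sum>i\<in>UNIV. a i j * a i k) = N / 4 * ((if j = k then 1 else 0) + 1)"
proof -
  have odd: "odd CARD('n)"
    using assms inverse_norm_identity defect_norm_even by fastforce
  have "16 / N\<^sup>2 * excess \<le> 0"
    using excess_odd_le[OF odd] by (intro mult_nonneg_nonpos) auto
  moreover have D: "0 \<le> (\<Sum>i\<in>UNIV. \<Sum>j\<in>UNIV. (defect i j)\<^sup>2)" by (intro sum_nonneg) auto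
  ultimately have "16 / N\<^sup>2 * excess = 0" and D0: "(\<Sum>i\<in>UNIV. \<Sum>j\<in>UNIV. (defect i j)\<^sup>2) = 0"
    using inverse_norm_identity assms by linarith+
  then have "excess = 0" using N_pos by simp
  note ra = excess_odd_eq[OF odd this]
  show "a i j \<in> {0, 1}" by (rule ra)
  have def0: "defect i j = 0" for i j
    using D0 by (simp add: sum_nonneg_eq_0_iff sum_nonneg)
  have b: "b j i = 4 / N * a i j - 2 / N" for i j
    using def0[of i j] N_pos by (simp add: defect_def ra(1) field_simps)
  define c where "c k = (\<Sum>i\<in>UNIV. a i k)" for k
  have M: "4 / N * (\<Sum>i\<in>UNIV. a i j * a i k) - 2 / N * c k = (if j = k then 1 else 0)" for j k
    using left_inverse[of j k] unfolding b
    by (simp add: left_diff_distrib sum_subtractf sum_distrib_left c_def mult.assoc)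
  \<comment> \<open>For 0/1 entries the diagonal of the Gram matrix consists of the column sums, so
    the diagonal equations determine them.\<close>
  have "a i k * a i k = a i k" for i k using ra(2)[of i k] by auto
  then have "(\<Sum>i\<in>UNIV. a i k * a i k) = c k" for k unfolding c_def by (intro sum.cong refl)
  then have c: "c k = N / 2" for k
    using M[of k k] N_pos by (simp add: field_simps)
  show "(\<Sum>i\<in>UNIV. a i j * a i k) = N / 4 * ((if j = k then 1 else 0) + 1)"
    using M[of j k] N_pos by (simp add: c field_simps split: if_splits)
qed

text \<open>If A^T A = M, then D^T A = M^{-1} A^T A - B A = 0, hence D = 0. The excess vanishes
  because tr M = n N/2 and 1^T M 1 = n N^2/4.\<close>

lemma inverse_norm_of_gram:
  assumes gram: "\<And>j k. (\<Sum>i\<in>UNIV. a i j * a i k) = N / 4 * ((if j = k then 1 else 0) + 1)"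
  shows "(\<Sum>i\<in>UNIV. \<Sum>j\<in>UNIV. (b j i)\<^sup>2) = 4 * (N - 1)\<^sup>2 / N\<^sup>2"
proof -
  have rk: "(\<Sum>i\<in>UNIV. rowsum i * a i k) = N\<^sup>2 / 4" for k
  proof -
    have "(\<Sum>i\<in>UNIV. rowsum i * a i k) = (\<Sum>j\<in>UNIV. \<Sum>i\<in>UNIV. a i j * a i k)"
      unfolding rowsum_def sum_distrib_right by (rule sum.swap)
    also have "\<dots> = N / 4 * (1 + (N - 1))"
      unfolding gram sum_distrib_left[symmetric] by (simp add: sum.distrib card_eq)
    finally show ?thesis by (simp add: power2_eq_square)
  qed
  have Da: "(\<Sum>i\<in>UNIV. defect i j * a i k) = 0" for j k
  proof -
    have "(\<Sum>i\<in>UNIV. defect i j * a i k)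
      = (\<Sum>i\<in>UNIV. 4 / N * (a i j * a i k) - 4 / N\<^sup>2 * (rowsum i * a i k) - b j i * a i k)"
      by (intro sum.cong refl) (simp add: defect_def algebra_simps power2_eq_square)
    also have "\<dots> = 4 / N * (N / 4 * ((if j = k then 1 else 0) + 1)) - 4 / N\<^sup>2 * (N\<^sup>2 / 4) - (if j = k then 1 else 0)"
      by (simp only: sum_subtractf gram rk left_inverse flip: sum_distrib_left)
    also have "\<dots> = 0" using N_pos by simp
    finally show ?thesis .
  qed
  have "defect l j = 0" for l j
  proof -
    have "0 = (\<Sum>k\<in>UNIV. (\<Sum>i\<in>UNIV. defect i j * a i k) * b k l)" by (simp add: Da)
    also have "\<dots> = (\<Sum>i\<in>UNIV. defect i j * (\<Sum>k\<in>UNIV. a i k * b k l))"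
      unfolding sum_distrib_left sum_distrib_right by (subst sum.swap) (simp add: mult.assoc)
    also have "\<dots> = defect l j" by (simp add: right_inverse if_distrib[of "(*) _"] cong: if_cong)
    finally show ?thesis by simp
  qed
  moreover have "excess = 0"
  proof -
    have "(\<Sum>i\<in>UNIV. \<Sum>j\<in>UNIV. (a i j)\<^sup>2) = (N - 1) * (N / 2)"
      by (subst sum.swap) (simp add: power2_eq_square gram card_eq)
    moreover have "(\<Sum>i\<in>UNIV. (rowsum i)\<^sup>2) = (N - 1) * (N\<^sup>2 / 4)"
    proof -
      have "(\<Sum>i\<in>UNIV. (rowsum i)\<^sup>2) = (\<Sum>i\<in>UNIV. \<Sum>k\<in>UNIV. rowsum i * a i k)"
        by (simp add: power2_eq_square rowsum_def sum_distrib_left)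
      also have "\<dots> = (N - 1) * (N\<^sup>2 / 4)"
        by (subst sum.swap) (simp add: rk card_eq)
      finally show ?thesis .
    qed
    ultimately have "excess = (N - 1) * (N / 2) - (N + 1) / N\<^sup>2 * ((N - 1) * (N\<^sup>2 / 4)) - (N - 1)\<^sup>2 / 4"
      unfolding excess_eq by (simp only:)
    then show ?thesis using N_pos by (simp add: field_simps power2_eq_square)
  qed
  ultimately show ?thesis using inverse_norm_identity by simp
qed

end

section \<open>Translation to matrices and norms\<close>

lemma frobenius_norm_eq:
  fixes B :: "real^'n^'m"
  shows "frobenius_norm B = sqrt (\<Sum>i\<in>UNIV. \<Sum>j\<in>UNIV. (B $ j $ i)\<^sup>2)"
  by (simp add: frobenius_norm_def trace_def matrix_matrix_mult_def transpose_def power2_eq_square)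

lemma frobenius_norm_scaleR:
  fixes B :: "real^'n^'m"
  shows "frobenius_norm (c *\<^sub>R B) = \<bar>c\<bar> * frobenius_norm B"
  by (simp add: frobenius_norm_eq power_mult_distrib real_sqrt_mult flip: sum_distrib_left)

lemma S_matrix_iff:
  fixes S :: "real^'n^'n"
  shows "S_matrix S \<longleftrightarrow> (\<forall>i j. S $ i $ j \<in> {0, 1}) \<and>
    (\<forall>j k. (\<Sum>i\<in>UNIV. S $ i $ j * S $ i $ k)
      = (real CARD('n) + 1) / 4 * ((if j = k then 1 else 0) + 1))"
  by (simp add: S_matrix_def vec_eq_iff matrix_matrix_mult_def transpose_def mat_def
      ones_column_def columnvector_def)

lemma unit_interval_inverse_matrix:
  fixes A B :: "real^'n^'n"
  assumes "\<And>i j. 0 \<le> A $ i $ j" "\<And>i j. A $ i $ j \<le> 1" "A ** B = mat 1" "B ** A = mat 1"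
  shows "unit_interval_inverse (\<lambda>i j. A $ i $ j) (\<lambda>i j. B $ i $ j) (real CARD('n) + 1)"
  using assms by unfold_locales
    (auto simp: vec_eq_iff matrix_matrix_mult_def mat_def)

lemma frobenius_norm_inverse_ge:
  fixes A B :: "real^'n^'n"
  assumes "\<And>i j. 0 \<le> A $ i $ j" "\<And>i j. A $ i $ j \<le> 1" "A ** B = mat 1" "B ** A = mat 1"
  shows "frobenius_norm B \<ge> 2 * real CARD('n) / (real CARD('n) + 1)"
    and "frobenius_norm B = 2 * real CARD('n) / (real CARD('n) + 1) \<longleftrightarrow> S_matrix A"
proof -
  interpret unit_interval_inverse "\<lambda>i j. A $ i $ j" "\<lambda>i j. B $ i $ j" "real CARD('n) + 1"
    using assms by (rule unit_interval_inverse_matrix)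
  define t where "t = 2 * real CARD('n) / (real CARD('n) + 1)"
  define s where "s = (\<Sum>i\<in>UNIV. \<Sum>j\<in>UNIV. (B $ j $ i)\<^sup>2)"
  have t: "t \<ge> 0" "4 * (real CARD('n) + 1 - 1)\<^sup>2 / (real CARD('n) + 1)\<^sup>2 = t\<^sup>2"
    by (simp_all add: t_def power_divide power_mult_distrib)
  have f: "frobenius_norm B = sqrt s" by (simp add: frobenius_norm_eq s_def)
  show "frobenius_norm B \<ge> 2 * real CARD('n) / (real CARD('n) + 1)"
    using inverse_norm_ge t unfolding f t_def[symmetric] s_def[symmetric]
    by (simp add: real_le_rsqrt)
  have "frobenius_norm B = t \<longleftrightarrow> s = t\<^sup>2"
    using t(1) unfolding f by (smt (verit) real_sqrt_abs real_sqrt_eq_iff)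
  also have "\<dots> \<longleftrightarrow> S_matrix A"
  proof
    assume "s = t\<^sup>2"
    then show "S_matrix A"
      using inverse_norm_eq_imp unfolding t(2) s_def S_matrix_iff by blast
  next
    assume "S_matrix A"
    then show "s = t\<^sup>2"
      using inverse_norm_of_gram unfolding t(2) s_def S_matrix_iff by blast
  qed
  finally show "frobenius_norm B = 2 * real CARD('n) / (real CARD('n) + 1) \<longleftrightarrow> S_matrix A"
    by (simp only: t_def)
qed

section \<open>Normalisation by the maximum norm\<close>

lemma max_norm_ge:
  fixes A :: "real^'n^'m"
  shows "\<bar>A $ i $ j\<bar> \<le> max_norm A"
proof -
  have "{\<bar>A $ i $ j\<bar> | i j. True} = (\<lambda>(i, j). \<bar>A $ i $ j\<bar>) ` UNIV" by auto
  then have "finite {\<bar>A $ i $ j\<bar> | i j. True}" by simp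
  then show ?thesis unfolding max_norm_def by (intro Max_ge) auto
qed

lemma max_norm_attained:
  fixes A :: "real^'n^'m"
  obtains i j where "max_norm A = \<bar>A $ i $ j\<bar>"
proof -
  have "{\<bar>A $ i $ j\<bar> | i j. True} = (\<lambda>(i, j). \<bar>A $ i $ j\<bar>) ` UNIV" by auto
  then have "finite {\<bar>A $ i $ j\<bar> | i j. True}" by simp
  moreover have "{\<bar>A $ i $ j\<bar> | i j. True} \<noteq> {}" by auto
  ultimately have "max_norm A \<in> {\<bar>A $ i $ j\<bar> | i j. True}"
    unfolding max_norm_def by (rule Max_in)
  then show ?thesis using that by blast
qed

text \<open>A nonzero 0/1 matrix has an entry 1. Thus the multiplier in A = c S is the maximum norm
  of A, and only one normalised matrix has to be tested.\<close>

lemma max_norm_scaled_zero_one: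
  fixes S :: "real^'n^'m"
  assumes "c > 0" "\<And>i j. S $ i $ j \<in> {0, 1}" "c *\<^sub>R S \<noteq> 0"
  shows "max_norm (c *\<^sub>R S) = c"
proof -
  obtain i j where "S $ i $ j \<noteq> 0" using assms(3) by (auto simp: vec_eq_iff)
  then have "S $ i $ j = 1" using assms(2)[of i j] by auto
  then have "c \<le> max_norm (c *\<^sub>R S)" using max_norm_ge[of "c *\<^sub>R S" i j] assms(1) by simp
  moreover obtain k l where "max_norm (c *\<^sub>R S) = \<bar>(c *\<^sub>R S) $ k $ l\<bar>"
    by (rule max_norm_attained)
  then have "max_norm (c *\<^sub>R S) \<le> c" using assms(1) assms(2)[of k l] by auto
  ultimately show ?thesis by simp
qed

theorem theorem1p1:
  fixes A :: "real^'n^'n"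
  assumes "invertible A"
    and "\<And>i j. 0 \<le> A $ i $ j"
  shows "(frobenius_norm (matrix_inv A)
            \<ge> 2 * real CARD('n) / (real CARD('n) + 1) * inverse (max_norm A)) \<and>
         (frobenius_norm (matrix_inv A)
            = 2 * real CARD('n) / (real CARD('n) + 1) * inverse (max_norm A)
          \<longleftrightarrow> (\<exists>(c::real) (S::real^'n^'n). c > 0 \<and> S_matrix S \<and> A = c *\<^sub>R S))"
proof -
  define m where "m = max_norm A"
  define B where "B = matrix_inv A"
  have inv: "A ** B = mat 1" "B ** A = mat 1"
    using someI_ex[of "\<lambda>B. A ** B = mat 1 \<and> B ** A = mat 1"] assms(1)
    by (simp_all add: B_def matrix_inv_def invertible_def)
  have "A \<noteq> 0"
  proof
    assume "A = 0"
    then have "(mat 1 :: real^'n^'n) $ i $ i = 0" for i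
      using inv(1)[symmetric] by (simp add: matrix_matrix_mult_def)
    then show False by (simp add: mat_def)
  qed
  then obtain i j where "A $ i $ j \<noteq> 0" by (auto simp: vec_eq_iff)
  then have m: "m > 0" using max_norm_ge[of A i j] by (simp add: m_def)
  have le: "A $ i $ j \<le> m" for i j
    using max_norm_ge[of A i j] by (simp add: m_def)
  have 1: "0 \<le> (inverse m *\<^sub>R A) $ i $ j" "(inverse m *\<^sub>R A) $ i $ j \<le> 1" for i j
    using m assms(2)[of i j] le[of i j] by (simp_all add: field_simps)
  have 2: "(inverse m *\<^sub>R A) ** (m *\<^sub>R B) = mat 1" "(m *\<^sub>R B) ** (inverse m *\<^sub>R A) = mat 1"
    using m inv by (simp_all add: matrix_scalar_ac scalar_matrix_assoc)
  note bound = frobenius_norm_inverse_ge[OF 1 2]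
  have "(\<exists>c S. c > 0 \<and> S_matrix S \<and> A = c *\<^sub>R S) \<longleftrightarrow> S_matrix (inverse m *\<^sub>R A)"
  proof
    assume "\<exists>c S. c > 0 \<and> S_matrix S \<and> A = c *\<^sub>R S"
    then obtain c S where S: "c > 0" "S_matrix S" "A = c *\<^sub>R S" by blast
    then have "m = c"
      unfolding m_def using max_norm_scaled_zero_one[of c S] \<open>A \<noteq> 0\<close> by (auto simp: S_matrix_def)
    then show "S_matrix (inverse m *\<^sub>R A)" using S by simp
  next
    assume "S_matrix (inverse m *\<^sub>R A)"
    then show "\<exists>c S. c > 0 \<and> S_matrix S \<and> A = c *\<^sub>R S"
      using m by (intro exI[of _ m] exI[of _ "inverse m *\<^sub>R A"]) simp
  qed
  \<comment> \<open>Moves the factor \<open>m\<close> between the norm of the scaled inverse and the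
    stated bound.\<close>
  moreover have "t * inverse m \<le> x \<longleftrightarrow> t \<le> \<bar>m\<bar> * x" "x = t * inverse m \<longleftrightarrow> \<bar>m\<bar> * x = t" for t x
    using m by (auto simp: field_simps)
  ultimately show ?thesis
    using bound unfolding B_def[symmetric] m_def[symmetric] frobenius_norm_scaleR by (simp only: simp_thms)
qed

end
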